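(* Let $E\in\mathbb R^{3\times n}$ with $\mathrm{rank}(E)=3$, and let its singular value decomposition be $$E=U_E\Sigma_EV_E^T,\qquad U_E\in O(3),\ V_E\in O(n),\ \Sigma_E\in\mathrm{Diag}^+(3,n),$$ with main diagonal entries $\sigma_1,\sigma_2,\sigma_3$ of $\Sigma_E$. Let the positive definite weight matrix $W$ be given by $W=V_EW_0V_E^T$, where $W_0\in\mathrm{Diag}^+(n,n)$ and the first three diagonal entries of $W_0$ are $$w_1=\frac{d_1}{\sigma_1^2},\quad w_2=\frac{d_2}{\sigma_2^2},\quad w_3=\frac{d_3}{\sigma_3^2},\qquad d_1,d_2,d_3>0.$$ Then $K=EWE^T$ is positive definite and $K=U_E\Delta U_E^T$, with $\Delta=\mathrm{diag}(d_1,d_2,d_3)$, is its eigendecomposition. Moreover, if $d_i\ne d_j$ for $i\neq j$, $i,j\in\{1,2,3\}$, then $Q\mapsto\langle I-Q,K\rangle$ is a Morse function on $SO(3)$ whose critical points are $$Q\in\{I,Q_1,Q_2,Q_3\},\qquad Q_i=2U_Ea_ia_i^TU_E^T-I,$$ where $a_i$ is the $i$th column vector of the $3\times 3$ identity matrix $I$.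
   Context: $\langle A_1,A_2\rangle=\mathrm{trace}(A_1^TA_2)$. $\mathrm{Diag}^+(n_1,n_2)$ is the set of $n_1\times n_2$ matrices with positive entries along the main diagonal and all other entries zero. A Morse function is a smooth function all of whose critical points are non-degenerate. *)

theory Defs
  imports "HOL-Analysis.Analysis"
begin

section \<open>Matrices\<close>

definition trace_inner :: "real^'m^'n \<Rightarrow> real^'m^'n \<Rightarrow> real" where
  "trace_inner A B = trace (transpose A ** B)"

definition positive_definite :: "real^'n^'n \<Rightarrow> bool" where
  "positive_definite A \<longleftrightarrow> transpose A = A \<and> (\<forall>x. x \<noteq> 0 \<longrightarrow> 0 < x \<bullet> (A *v x))"

definition diag_matrix :: "real^'n \<Rightarrow> real^'n^'n" where
  "diag_matrix d = (\<chi> i j. if i = j then d $ i else 0)"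

text \<open>
  The main diagonal of a rectangular matrix relates rows and columns indexed by different types.
  Index types are linearly ordered, and \<open>index_pos i\<close> is the position of \<open>i\<close>, counted from 0.
  The three elements of the type \<open>3\<close> are \<open>0 < 1 < 2\<close> (the numeral 3 denotes 0 there), so
  the row or column called 1, 2, 3 on paper is the one with index 0, 1, 2.
\<close>

definition index_pos :: "'n::{finite,linorder} \<Rightarrow> nat" where
  "index_pos i = card {j. j < i}"

definition Diag_plus :: "(real^'n::{finite,linorder}^'m::{finite,linorder}) set" where
  "Diag_plus = {A. \<forall>i j. if index_pos i = index_pos j then 0 < A $ i $ j else A $ i $ j = 0}"

definition eigendecomposition :: "real^'n^'n \<Rightarrow> real^'n^'n \<Rightarrow> real^'n \<Rightarrow> bool" where
  "eigendecomposition K U d \<longleftrightarrow>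
     orthogonal_matrix U \<and>
     (\<forall>i. K *v column i U = d $ i *\<^sub>R column i U) \<and>
     K = U ** diag_matrix d ** transpose U"

definition SO3 :: "(real^3^3) set" where
  "SO3 = {Q. rotation_matrix Q}"

section \<open>Smooth functions on embedded submanifolds\<close>

text \<open>For open \<open>S\<close> in a Euclidean space this is the usual class of k times continuously
  differentiable functions, expressed by iterated directional derivatives.\<close>

primrec Ck_on :: "nat \<Rightarrow> ('a::euclidean_space \<Rightarrow> 'b::real_normed_vector) \<Rightarrow> 'a set \<Rightarrow> bool" where
  "Ck_on 0 f S \<longleftrightarrow> continuous_on S f"
| "Ck_on (Suc k) f S \<longleftrightarrow>
     (\<forall>x\<in>S. f differentiable (at x)) \<and>
     (\<forall>v. Ck_on k (\<lambda>x. frechet_derivative f (at x) v) S)"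

definition smooth_on :: "('a::euclidean_space \<Rightarrow> 'b::real_normed_vector) \<Rightarrow> 'a set \<Rightarrow> bool" where
  "smooth_on f S \<longleftrightarrow> (\<forall>k. Ck_on k f S)"

text \<open>The type \<open>'e\<close> is the Euclidean model space; its dimension is the dimension of \<open>M\<close>.
  It is passed explicitly where it does not occur in the other arguments.\<close>

definition local_param ::
    "'a::euclidean_space set \<Rightarrow> 'e::euclidean_space set \<Rightarrow> ('e \<Rightarrow> 'a) \<Rightarrow> bool" where
  "local_param M U \<phi> \<longleftrightarrow>
     open U \<and> smooth_on \<phi> U \<and>
     (\<forall>u\<in>U. inj (frechet_derivative \<phi> (at u))) \<and>
     openin (top_of_set M) (\<phi> ` U) \<and>
     (\<exists>\<psi>. homeomorphism U (\<phi> ` U) \<phi> \<psi>)"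

definition embedded_submanifold ::
    "'e::euclidean_space itself \<Rightarrow> 'a::euclidean_space set \<Rightarrow> bool" where
  "embedded_submanifold E M \<longleftrightarrow>
     (\<forall>x\<in>M. \<exists>(U :: 'e set) \<phi>. local_param M U \<phi> \<and> x \<in> \<phi> ` U)"

definition smooth_function_on ::
    "'e::euclidean_space itself \<Rightarrow> 'a::euclidean_space set \<Rightarrow> ('a \<Rightarrow> real) \<Rightarrow> bool" where
  "smooth_function_on E M f \<longleftrightarrow>
     (\<forall>(U :: 'e set) \<phi>. local_param M U \<phi> \<longrightarrow> smooth_on (f \<circ> \<phi>) U)"

text \<open>On an embedded submanifold, with \<open>f\<close> smooth, the next two notions do not depend on the
  parametrization. With the existential quantifier in the first and the universal one in the
  second, neither can hold for lack of parametrizations.\<close>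

definition critical_point ::
    "'e::euclidean_space itself \<Rightarrow> 'a::euclidean_space set \<Rightarrow> ('a \<Rightarrow> real) \<Rightarrow> 'a \<Rightarrow> bool" where
  "critical_point E M f x \<longleftrightarrow>
     (\<exists>(U :: 'e set) \<phi> u. local_param M U \<phi> \<and> u \<in> U \<and> \<phi> u = x \<and>
        ((f \<circ> \<phi>) has_derivative (\<lambda>_. 0)) (at u))"

definition hessian :: "('e::euclidean_space \<Rightarrow> real) \<Rightarrow> 'e \<Rightarrow> 'e \<Rightarrow> 'e \<Rightarrow> real" where
  "hessian g u h k =
     frechet_derivative (\<lambda>v. frechet_derivative g (at v) h) (at u) k"

definition nondegenerate_critical_point ::
    "'e::euclidean_space itself \<Rightarrow> 'a::euclidean_space set \<Rightarrow> ('a \<Rightarrow> real) \<Rightarrow> 'a \<Rightarrow> bool" where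
  "nondegenerate_critical_point E M f x \<longleftrightarrow>
     critical_point E M f x \<and>
     (\<forall>(U :: 'e set) \<phi> u. local_param M U \<phi> \<and> u \<in> U \<and> \<phi> u = x \<longrightarrow>
        (\<forall>h. (\<forall>k. hessian (f \<circ> \<phi>) u h k = 0) \<longrightarrow> h = 0))"

definition morse_function_on ::
    "'e::euclidean_space itself \<Rightarrow> 'a::euclidean_space set \<Rightarrow> ('a \<Rightarrow> real) \<Rightarrow> bool" where
  "morse_function_on E M f \<longleftrightarrow>
     embedded_submanifold E M \<and> smooth_function_on E M f \<and>
     (\<forall>x. critical_point E M f x \<longrightarrow> nondegenerate_critical_point E M f x)"

end

theory Submission
  imports Defs
begin

text \<open>
  In a chart \<open>\<phi>\<close> of \<open>SO3\<close> the derivative is \<open>\<partial>\<^sub>h \<phi> = \<phi> [L h]\<close> with \<open>[\<cdot>]\<close> skew-symmetric and \<open>L\<close> bijective, so \<open>Q\<close> is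
  critical for \<open>Q \<mapsto> \<langle>I - Q, K\<rangle>\<close> iff \<open>S = Q\<^sup>T K\<close> is symmetric. Conjugating by the eigenvector matrix of
  \<open>K\<close> and using that its eigenvalues are distinct and positive, this forces the conjugate of \<open>Q\<close> to be
  diagonal with entries \<open>e\<^sub>i = 1\<close> or \<open>e\<^sub>i = - 1\<close> of product 1. There the Hessian is \<open>(tr S) I - S\<close> in the coordinates
  \<open>L h\<close>; its eigenvalues \<open>e\<^sub>j d\<^sub>j + e\<^sub>k d\<^sub>k\<close> do not vanish. Charts come from the Cayley parametrization,
  translated to each rotation.
\<close>

section \<open>Calculus of \<open>C\<^sup>k\<close> maps\<close>

text \<open>Openness turns agreement on \<open>S\<close> into agreement near each point of
  \<open>S\<close>, so the derivatives agree there too and the induction can pass to them.\<close>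

lemma Ck_on_cong:
  assumes "open S" "\<And>x. x \<in> S \<Longrightarrow> f x = g x"
  shows "Ck_on k f S \<longleftrightarrow> Ck_on k g S"
  using assms(2)
proof (induction k arbitrary: f g)
  case 0
  then show ?case by (simp cong: continuous_on_cong)
next
  case (Suc k)
  have "(f has_derivative D) (at x) \<longleftrightarrow> (g has_derivative D) (at x)" if "x \<in> S" for x D
    by (rule iffI; erule has_derivative_transform_within_open[OF _ assms(1) that])
      (simp_all add: Suc.prems)
  then have *: "f differentiable at x \<longleftrightarrow> g differentiable at x"
    "frechet_derivative f (at x) = frechet_derivative g (at x)" if "x \<in> S" for x
    using that by (simp_all add: differentiable_def frechet_derivative_def)
  then show ?case
    using Suc.IH[of "\<lambda>x. frechet_derivative f (at x) v" "\<lambda>x. frechet_derivative g (at x) v" for v]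
    by simp
qed

text \<open>Lets an explicit derivative formula stand in for \<open>frechet_derivative\<close>. The
  inductions for sums, products and inverses all take their step through it.\<close>

lemma Ck_on_SucI:
  assumes "open S" and f: "\<And>x. x \<in> S \<Longrightarrow> (f has_derivative f' x) (at x)"
    and "\<And>v. Ck_on k (\<lambda>x. f' x v) S"
  shows "Ck_on (Suc k) f S"
proof -
  have "Ck_on k (\<lambda>x. frechet_derivative f (at x) v) S" for v
    using assms(3)[of v] Ck_on_cong[OF assms(1), of "\<lambda>x. frechet_derivative f (at x) v" "\<lambda>x. f' x v" k]
      frechet_derivative_at[OF f] by simp
  then show ?thesis
    using f by (auto simp: differentiable_def)
qed

lemma Ck_on_SucD: "Ck_on (Suc k) f S \<Longrightarrow> Ck_on k f S"
proof (induction k arbitrary: f)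
  case 0
  then show ?case
    by (auto intro: differentiable_imp_continuous_on differentiable_at_imp_differentiable_on)
next
  case (Suc k)
  then show ?case by simp
qed

lemma Ck_on_Suc_derivative:
  assumes "Ck_on (Suc k) f S" "x \<in> S"
  shows "(f has_derivative frechet_derivative f (at x)) (at x)"
  using assms frechet_derivative_works by auto

lemma Ck_on_const: "Ck_on k (\<lambda>_. c) S"
  by (induction k arbitrary: c) auto

lemma Ck_on_bounded_linear:
  assumes "bounded_linear f"
  shows "Ck_on k f S"
proof (cases k)
  case 0
  then show ?thesis using assms by (simp add: linear_continuous_on)
next
  case (Suc j)
  have "frechet_derivative f (at x) = f" for x
    using assms bounded_linear_imp_has_derivative frechet_derivative_at by metis
  then show ?thesis
    using Suc assms by (simp add: Ck_on_const bounded_linear_imp_differentiable)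
qed

lemma Ck_on_add:
  assumes "open S" "Ck_on k f S" "Ck_on k g S"
  shows "Ck_on k (\<lambda>x. f x + g x) S"
  using assms(2,3)
proof (induction k arbitrary: f g)
  case 0
  then show ?case by (simp add: continuous_on_add)
next
  case (Suc k)
  show ?case
    by (rule Ck_on_SucI[OF assms(1) has_derivative_add[OF
          Ck_on_Suc_derivative[OF Suc.prems(1)] Ck_on_Suc_derivative[OF Suc.prems(2)]]])
      (use Suc in auto)
qed

lemma Ck_on_linear_compose:
  assumes "open S" "bounded_linear L" "Ck_on k f S"
  shows "Ck_on k (\<lambda>x. L (f x)) S"
  using assms(3)
proof (induction k arbitrary: f)
  case 0
  then show ?case using assms(2) by (simp add: bounded_linear.continuous_on)
next
  case (Suc k)
  show ?case
    by (rule Ck_on_SucI[OF assms(1) bounded_linear.has_derivative[OF assms(2)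
          Ck_on_Suc_derivative[OF Suc.prems(1)]]]) (use Suc in auto)
qed

text \<open>By the Leibniz rule each directional derivative is a sum of two terms of the same
  bilinear shape, in which one factor is differentiated and the other keeps a spare degree of
  smoothness. Scalar, inner, outer and matrix products are all instances.\<close>

lemma Ck_on_bilinear:
  assumes "open S" "bounded_bilinear B" "Ck_on k f S" "Ck_on k g S"
  shows "Ck_on k (\<lambda>x. B (f x) (g x)) S"
  using assms(3,4)
proof (induction k arbitrary: f g)
  case 0
  then show ?case using assms(2) by (simp add: bounded_bilinear.continuous_on)
next
  case (Suc k)
  show ?case
    by (rule Ck_on_SucI[OF assms(1) bounded_bilinear.FDERIV[OF assms(2)
          Ck_on_Suc_derivative[OF Suc.prems(1)] Ck_on_Suc_derivative[OF Suc.prems(2)]]])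
      (use Suc.prems Suc.prems[THEN Ck_on_SucD] in \<open>auto intro!: Ck_on_add[OF assms(1)] Suc.IH\<close>)
qed

text \<open>The derivative of \<open>inverse (f x)\<close> is a product of the derivative of
  \<open>f\<close> with two copies of \<open>inverse (f x)\<close>; the induction hypothesis covers
  the latter.\<close>

lemma Ck_on_inverse:
  fixes f :: "'a::euclidean_space \<Rightarrow> real"
  assumes "open S" "\<And>x. x \<in> S \<Longrightarrow> f x \<noteq> 0" "Ck_on k f S"
  shows "Ck_on k (\<lambda>x. inverse (f x)) S"
  using assms(3)
proof (induction k)
  case 0
  then show ?case using assms(2) by (simp add: continuous_on_inverse)
next
  case (Suc k)
  have inv: "Ck_on k (\<lambda>x. inverse (f x)) S"
    using Suc by (blast dest: Ck_on_SucD)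
  note mult = Ck_on_bilinear[OF assms(1) bounded_bilinear_mult]
  have D: "Ck_on k (\<lambda>x. frechet_derivative f (at x) v) S" for v
    using Suc.prems by simp
  show ?case
    by (rule Ck_on_SucI[OF assms(1) Deriv.has_derivative_inverse[OF assms(2)
          Ck_on_Suc_derivative[OF Suc.prems]]])
      (auto intro!: Ck_on_linear_compose[OF assms(1) bounded_linear_minus[OF bounded_linear_ident]] mult inv D)
qed

lemma smooth_on_derivative:
  assumes "smooth_on f S" "x \<in> S"
  shows "(f has_derivative frechet_derivative f (at x)) (at x)"
  using assms Ck_on_Suc_derivative unfolding smooth_on_def by blast

lemma smooth_on_frechet_derivative:
  assumes "smooth_on f S"
  shows "smooth_on (\<lambda>x. frechet_derivative f (at x) v) S"
  unfolding smooth_on_def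
proof
  fix k
  have "Ck_on (Suc k) f S"
    using assms by (simp only: smooth_on_def)
  then show "Ck_on k (\<lambda>x. frechet_derivative f (at x) v) S"
    by simp
qed

section \<open>Matrices\<close>

lemma matrix_add_right_distrib:
  fixes A B :: "real^'n^'m"
  shows "(A + B) ** C = A ** C + B ** C"
  by (simp add: vec_eq_iff matrix_matrix_mult_def sum.distrib distrib_right)

lemma bounded_bilinear_matrix_matrix_mult:
  "bounded_bilinear ((**) :: real^'n^'m \<Rightarrow> real^'p^'n \<Rightarrow> real^'p^'m)"
  unfolding bilinear_conv_bounded_bilinear[symmetric] bilinear_def
  by (intro conjI allI linearI)
    (simp_all add: matrix_add_ldistrib matrix_add_right_distrib scalar_matrix_assoc matrix_scalar_ac)

lemma bounded_linear_transpose: "bounded_linear (transpose :: real^'n^'m \<Rightarrow> real^'m^'n)"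
  unfolding linear_conv_bounded_linear[symmetric]
  by (auto intro!: linearI simp: vec_eq_iff transpose_def)

lemma bounded_linear_trace: "bounded_linear (trace :: real^'n^'n \<Rightarrow> real)"
  unfolding linear_conv_bounded_linear[symmetric]
  by (auto intro!: linearI simp: trace_def sum.distrib sum_distrib_left)

text \<open>Identifies the trace form with the Euclidean inner product of the matrix type, which
  makes the inner product calculus available.\<close>

lemma trace_inner_eq_inner: "trace_inner A B = A \<bullet> B"
  unfolding trace_inner_def trace_def inner_vec_def matrix_matrix_mult_def transpose_def
  by (simp, rule sum.swap)

lemma inner_transpose: "transpose A \<bullet> transpose B = (A \<bullet> B :: real)"
  unfolding inner_vec_def transpose_def by (simp, rule sum.swap)

lemma inner_matrix_mult_left:
  fixes A :: "real^'n^'m"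
  shows "(A ** B) \<bullet> C = B \<bullet> (transpose A ** C)"
  by (simp add: trace_inner_eq_inner[symmetric] trace_inner_def matrix_transpose_mul matrix_mul_assoc)

lemma matrix_mult_diag_nth [simp]:
  fixes A :: "real^'n^'m" and B :: "real^'m^'n"
  shows "(A ** diag_matrix d) $ i $ j = A $ i $ j * d $ j"
    and "(diag_matrix d ** B) $ j $ i = d $ j * B $ j $ i"
  by (simp_all add: matrix_matrix_mult_def diag_matrix_def if_distrib[of "(*) _"]
      if_distrib[of "\<lambda>x. x * _"] cong: if_cong)

lemma diag_matrix_mult_vector_nth [simp]: "(diag_matrix d *v x) $ i = d $ i * x $ i"
  by (simp add: matrix_vector_mult_def diag_matrix_def if_distrib[of "\<lambda>x. x * _"] cong: if_cong)

lemma transpose_diag_matrix [simp]: "transpose (diag_matrix d) = diag_matrix d"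
  by (auto simp: vec_eq_iff transpose_def diag_matrix_def)

lemma diag_matrix_mult: "diag_matrix a ** diag_matrix b = diag_matrix (\<chi> i. a $ i * b $ i)"
  by (simp add: vec_eq_iff) (simp add: diag_matrix_def)

lemma diag_matrix_1: "diag_matrix (\<chi> i. 1) = mat 1"
  by (simp add: vec_eq_iff diag_matrix_def mat_def)

lemma trace_diag_matrix: "trace (diag_matrix d) = sum (($) d) UNIV"
  by (simp add: trace_def diag_matrix_def)

lemma det_diag_matrix: "det (diag_matrix d) = prod (($) d) UNIV"
  by (subst det_diagonal) (simp_all add: diag_matrix_def)

section \<open>Orthogonal conjugates of diagonal matrices\<close>

text \<open>In the coordinates \<open>z = transpose U *v x\<close> the quadratic form is the sum of
  \<open>d $ i * (z $ i)\<^sup>2\<close>, and \<open>z\<close> is nonzero because \<open>U\<close>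
  is invertible.\<close>

lemma positive_definite_diag_conj:
  fixes U :: "real^'n^'n"
  assumes U: "orthogonal_matrix U" and d: "\<And>i. 0 < d $ i"
  shows "positive_definite (U ** diag_matrix d ** transpose U)"
  unfolding positive_definite_def
proof (intro conjI allI impI)
  show "transpose (U ** diag_matrix d ** transpose U) = U ** diag_matrix d ** transpose U"
    by (simp add: matrix_transpose_mul matrix_mul_assoc)
  fix x :: "real^'n" assume "x \<noteq> 0"
  define z where "z = transpose U *v x"
  have "U *v z = x"
    using U by (simp add: z_def matrix_vector_mul_assoc orthogonal_matrix_def del: transpose_matrix_vector)
  with \<open>x \<noteq> 0\<close> have "z \<noteq> 0" by auto
  then obtain i where "z $ i \<noteq> 0" by (auto simp: vec_eq_iff)
  have "x \<bullet> ((U ** diag_matrix d ** transpose U) *v x) = z \<bullet> (diag_matrix d *v z)"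
    by (simp add: z_def matrix_vector_mul_assoc[symmetric] dot_lmul_matrix[symmetric])
  also have "\<dots> = (\<Sum>i\<in>UNIV. d $ i * (z $ i)\<^sup>2)"
    by (simp add: inner_vec_def power2_eq_square mult_ac)
  also have "\<dots> > 0"
    using d \<open>z $ i \<noteq> 0\<close> by (intro sum_pos2[of _ i]) (auto simp: less_imp_le)
  finally show "0 < x \<bullet> ((U ** diag_matrix d ** transpose U) *v x)" .
qed

lemma eigendecomposition_diag_conj:
  fixes U :: "real^'n^'n"
  assumes U: "orthogonal_matrix U"
  shows "eigendecomposition (U ** diag_matrix d ** transpose U) U d"
proof -
  have UU: "transpose U ** U = mat 1"
    using U by (simp add: orthogonal_matrix)
  have "(U ** diag_matrix d ** transpose U) *v column i U = d $ i *\<^sub>R column i U" for i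
  proof -
    have "(U ** diag_matrix d ** transpose U) *v column i U
        = column i (U ** diag_matrix d ** transpose U ** U)"
      by (simp add: matrix_vector_mul_assoc flip: matrix_vector_mult_basis)
    also have "U ** diag_matrix d ** transpose U ** U = U ** diag_matrix d"
      by (simp add: matrix_mul_assoc[symmetric] UU)
    also have "column i (U ** diag_matrix d) = d $ i *\<^sub>R column i U"
      by (simp add: vec_eq_iff column_def)
    finally show ?thesis .
  qed
  then show ?thesis
    using U by (simp add: eigendecomposition_def)
qed

section \<open>The singular value decomposition\<close>

lemma index_pos_less: "index_pos i < index_pos j" if "i < j"
  unfolding index_pos_def using that by (intro psubset_card_mono) auto

lemma index_pos_eq_iff [simp]: "index_pos i = index_pos j \<longleftrightarrow> i = j"
  by (metis index_pos_less less_irrefl neqE)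

lemma bij_betw_index_pos: "bij_betw index_pos (UNIV :: 'n::{finite,linorder} set) {..<CARD('n)}"
proof -
  have "range (index_pos :: 'n \<Rightarrow> nat) \<subseteq> {..<CARD('n)}"
    unfolding index_pos_def by (auto intro!: psubset_card_mono)
  then show ?thesis
    by (simp add: bij_betw_def inj_def card_image card_subset_eq)
qed

text \<open>Positions run through an initial segment of the naturals, so every row of a matrix with
  at least as many columns as rows meets the main diagonal.\<close>

lemma obtain_index_pos:
  assumes "CARD('m) \<le> CARD('n)"
  obtains j :: "'n::{finite,linorder}" where "index_pos (i :: 'm::{finite,linorder}) = index_pos j"
proof -
  have "index_pos i < CARD('m)"
    using bij_betw_index_pos[where 'n='m] by (auto simp: bij_betw_def)
  then have "index_pos i \<in> range (index_pos :: 'n \<Rightarrow> nat)"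
    using assms bij_betw_index_pos[where 'n='n] by (simp add: bij_betw_def)
  then show ?thesis using that by auto
qed

text \<open>Row \<open>i\<close> of \<open>S\<close> has a single nonzero entry,
  \<open>\<sigma> $ i\<close> on the main diagonal. Hence one summand of each matrix product
  survives, and the weight \<open>d $ i / (\<sigma> $ i)\<^sup>2\<close> cancels the squared
  singular value.\<close>

lemma Diag_plus_conj:
  fixes S :: "real^'n::{finite,linorder}^'m::{finite,linorder}" and W :: "real^'n::{finite,linorder}^'n::{finite,linorder}"
  assumes card: "CARD('m) \<le> CARD('n)" and S: "S \<in> Diag_plus" and W: "W \<in> Diag_plus"
    and \<sigma>: "\<And>i j. index_pos i = index_pos j \<Longrightarrow> S $ i $ j = \<sigma> $ i"
    and w: "\<And>i j. index_pos i = index_pos j \<Longrightarrow> W $ j $ j = d $ i / (\<sigma> $ i)\<^sup>2"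
  shows "S ** W ** transpose S = diag_matrix d"
proof -
  \<comment> \<open>Since \<open>index_pos\<close> is injective, a square matrix in
    \<open>Diag_plus\<close> is diagonal in the usual sense.\<close>
  have "diag_matrix (\<chi> k. W $ k $ k) $ k $ l = W $ k $ l" for k l
    using W[unfolded Diag_plus_def mem_Collect_eq, rule_format, of k l]
    by (simp add: diag_matrix_def split: if_splits)
  then have W': "diag_matrix (\<chi> k. W $ k $ k) = W"
    by (simp only: vec_eq_iff) simp
  have SW: "(S ** W) $ i $ l = S $ i $ l * W $ l $ l" for i l
    using matrix_mult_diag_nth(1)[of S "\<chi> k. W $ k $ k" i l] by (simp add: W')
  have "(S ** W ** transpose S) $ i $ j = diag_matrix d $ i $ j" for i j
  proof -
    obtain k :: 'n where k: "index_pos i = index_pos k"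
      using obtain_index_pos[OF card] by blast
    have S0: "S $ i $ l = 0" if "l \<noteq> k" for l
      using S[unfolded Diag_plus_def mem_Collect_eq, rule_format, of i l] that
      by (simp add: k split: if_splits)
    have "0 < S $ i $ k"
      using S[unfolded Diag_plus_def mem_Collect_eq, rule_format, of i k] by (simp add: k)
    then have \<sigma>i: "S $ i $ k = \<sigma> $ i" "0 < \<sigma> $ i"
      using \<sigma>[OF k] by auto
    have Sj: "S $ j $ k = (if i = j then \<sigma> $ i else 0)"
      using S[unfolded Diag_plus_def mem_Collect_eq, rule_format, of j k] \<sigma>i
      by (auto simp flip: k split: if_splits)
    have "(S ** W ** transpose S) $ i $ j = (\<Sum>l\<in>UNIV. (S ** W) $ i $ l * S $ j $ l)"
      by (simp add: matrix_matrix_mult_def[of "S ** W"] transpose_def)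
    also have "\<dots> = (\<Sum>l\<in>UNIV. S $ i $ l * W $ l $ l * S $ j $ l)"
      by (simp only: SW)
    also have "\<dots> = (\<Sum>l\<in>{k}. S $ i $ l * W $ l $ l * S $ j $ l)"
      by (rule sum.mono_neutral_right) (auto simp: S0)
    also have "\<dots> = diag_matrix d $ i $ j"
      using \<sigma>i w[OF k] by (auto simp: Sj diag_matrix_def power2_eq_square)
    finally show ?thesis .
  qed
  then show ?thesis by (simp add: vec_eq_iff)
qed

section \<open>The Cayley parametrization\<close>

definition outer :: "real^'m \<Rightarrow> real^'n \<Rightarrow> real^'n^'m" where
  "outer u v = (\<chi> i j. u $ i * v $ j)"

lemma outer_nth [simp]: "outer u v $ i $ j = u $ i * v $ j"
  by (simp add: outer_def)

text \<open>The matrix of the cross product with \<open>w\<close> from the left.\<close>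

definition skew :: "real^3 \<Rightarrow> real^3^3" where
  "skew w = vector [vector [0, - w$3, w$2], vector [w$3, 0, - w$1], vector [- w$2, w$1, 0]]"

text \<open>Without a factor 1/2, so \<open>axial (skew w)\<close> is
  \<open>2 *\<^sub>R w\<close>.\<close>

definition axial :: "real^3^3 \<Rightarrow> real^3" where
  "axial A = vector [A$3$2 - A$2$3, A$1$3 - A$3$1, A$2$1 - A$1$2]"

lemma bounded_bilinear_outer: "bounded_bilinear outer"
  unfolding bilinear_conv_bounded_bilinear[symmetric] bilinear_def
  by (auto intro!: linearI simp: vec_eq_iff algebra_simps)

lemma bounded_linear_skew: "bounded_linear skew"
  unfolding linear_conv_bounded_linear[symmetric]
  by (auto intro!: linearI simp: vec_eq_iff forall_3 skew_def algebra_simps)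

lemma bounded_linear_axial: "bounded_linear axial"
  unfolding linear_conv_bounded_linear[symmetric]
  by (auto intro!: linearI simp: vec_eq_iff forall_3 axial_def algebra_simps)

lemma transpose_skew: "transpose (skew w) = - skew w"
  by (simp add: vec_eq_iff forall_3 skew_def transpose_def)

lemma skew_axial: "skew (axial A) = A - transpose A"
  by (simp add: vec_eq_iff forall_3 skew_def axial_def transpose_def)

lemma skew_symmetric_eq_skew:
  assumes "transpose A = - A"
  shows "A = skew ((1/2) *\<^sub>R axial A)"
proof -
  have "skew ((1/2) *\<^sub>R axial A) = (1/2) *\<^sub>R (A - transpose A)"
    by (simp add: linear_cmul[OF bounded_linear.linear[OF bounded_linear_skew]] skew_axial)
  then show ?thesis
    using assms by simp
qed

text \<open>The triple product identity a x (b x c) = b (a . c) - c (a . b), with the sign reversed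
  by the transpose. It gives the Hessian its form.\<close>

lemma transpose_skew_mult_skew:
  "transpose (skew a) ** skew b = (a \<bullet> b) *\<^sub>R mat 1 - outer b a"
  by (simp add: vec_eq_iff forall_3 skew_def transpose_def matrix_matrix_mult_def sum_3
      inner_vec_def mat_def algebra_simps)

text \<open>Pairing \<open>S\<close> with \<open>skew w\<close> amounts to pairing
  \<open>axial S\<close> with \<open>w\<close>, and \<open>axial S\<close> vanishes exactly when
  \<open>S\<close> is symmetric. This converts a vanishing first derivative into a symmetry
  condition.\<close>

lemma inner_skew_symmetric:
  fixes S :: "real^3^3"
  shows "(\<forall>w. skew w \<bullet> S = 0) \<longleftrightarrow> transpose S = S"
proof -
  have "skew w \<bullet> S = w \<bullet> axial S" for w
    by (simp add: inner_vec_def sum_3 skew_def axial_def algebra_simps)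
  then have "(\<forall>w. skew w \<bullet> S = 0) \<longleftrightarrow> axial S = 0"
    by (metis inner_eq_zero_iff inner_zero_right)
  also have "\<dots> \<longleftrightarrow> transpose S = S"
    by (auto simp: vec_eq_iff forall_3 axial_def transpose_def)
  finally show ?thesis .
qed

text \<open>The matrix of the conjugation \<open>x \<mapsto> (1 + u) x (1 + u)\<^sup>-\<^sup>1\<close> by a quaternion, equivalently
  the Cayley transform of the skew-symmetric matrix \<open>skew u\<close>.\<close>

definition cayley :: "real^3 \<Rightarrow> real^3^3" where
  "cayley u = inverse (1 + u \<bullet> u) *\<^sub>R
     ((1 - u \<bullet> u) *\<^sub>R mat 1 + 2 *\<^sub>R outer u u + 2 *\<^sub>R skew u)"

text \<open>For \<open>Q = cayley u\<close> both \<open>1 + trace Q\<close> and the factor of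
  \<open>u\<close> in \<open>axial Q\<close> equal \<open>4 / (1 + u \<bullet> u)\<close>, so the
  quotient is \<open>u\<close>. The rotations with zero denominator are the half-turns.\<close>

definition cayley_inv :: "real^3^3 \<Rightarrow> real^3" where
  "cayley_inv Q = inverse (1 + trace Q) *\<^sub>R axial Q"

lemma one_plus_inner_pos: "0 < 1 + u \<bullet> (u :: 'a::real_inner)"
  using inner_ge_zero[of u] by linarith

lemma cayley_0 [simp]: "cayley 0 = mat 1"
  using bounded_bilinear.zero_left[OF bounded_bilinear_outer]
    linear_0[OF bounded_linear.linear[OF bounded_linear_skew]]
  by (simp add: cayley_def)

text \<open>Without its denominator the matrix is that of x to p x p* for the quaternion p = 1 + u
  of squared norm \<open>q\<close>. It therefore multiplies lengths by \<open>q\<close> and volumes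
  by \<open>q ^ 3\<close>, which is checked as polynomial identities in the coordinates.\<close>

lemma rotation_cayley: "rotation_matrix (cayley u)"
proof -
  define q where "q = 1 + u \<bullet> u"
  define P where "P = (1 - u \<bullet> u) *\<^sub>R mat 1 + 2 *\<^sub>R outer u u + 2 *\<^sub>R skew u"
  have q: "q \<noteq> 0"
    using one_plus_inner_pos[of u] by (simp add: q_def)
  have c: "cayley u = inverse q *\<^sub>R P"
    by (simp add: cayley_def q_def P_def)
  obtain x y z where xyz: "u $ 1 = x" "u $ 2 = y" "u $ 3 = z"
    by blast
  have PP: "transpose P ** P = q\<^sup>2 *\<^sub>R mat 1"
    by (simp add: P_def q_def vec_eq_iff forall_3 skew_def transpose_def matrix_matrix_mult_def sum_3
      inner_vec_def mat_def xyz) algebra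
  have "det P = q ^ 3"
    by (simp add: det_3 P_def q_def skew_def inner_vec_def mat_def xyz sum_3) algebra
  moreover have "det (cayley u) = inverse q ^ 3 * det P"
    unfolding c by (simp add: det_3 algebra_simps power3_eq_cube)
  ultimately have "det (cayley u) = 1"
    using q by (simp add: field_simps)
  moreover have "transpose (cayley u) ** cayley u = mat 1"
    using q by (simp add: c transpose_scalar scalar_matrix_assoc[symmetric] matrix_scalar_ac PP
        power2_eq_square field_simps)
  ultimately show ?thesis
    by (simp add: rotation_matrix_def orthogonal_matrix)
qed

lemma trace_cayley: "1 + trace (cayley u) = 4 * inverse (1 + u \<bullet> u)"
proof -
  have "trace ((1 - u \<bullet> u) *\<^sub>R mat 1 + 2 *\<^sub>R outer u u + 2 *\<^sub>R skew u) = 3 - u \<bullet> u"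
    by (simp add: trace_def sum_3 mat_def skew_def inner_vec_def algebra_simps)
  then have "trace (cayley u) = inverse (1 + u \<bullet> u) * (3 - u \<bullet> u)"
    by (simp add: cayley_def linear_cmul[OF bounded_linear.linear[OF bounded_linear_trace]])
  then show ?thesis
    using one_plus_inner_pos[of u] by (simp add: field_simps)
qed

lemma cayley_inv_cayley: "cayley_inv (cayley u) = u"
proof -
  have "axial ((1 - u \<bullet> u) *\<^sub>R mat 1 + 2 *\<^sub>R outer u u + 2 *\<^sub>R skew u) = 4 *\<^sub>R u"
    by (simp add: vec_eq_iff forall_3 axial_def mat_def skew_def algebra_simps)
  then have "axial (cayley u) = (4 * inverse (1 + u \<bullet> u)) *\<^sub>R u"
    by (simp add: cayley_def linear_cmul[OF bounded_linear.linear[OF bounded_linear_axial]])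
  then show ?thesis
    using one_plus_inner_pos[of u] by (simp add: cayley_inv_def trace_cayley)
qed

text \<open>Rotations preserve cross products, so two columns in cyclic order multiply to the third:
  the matrix is its own cofactor matrix.\<close>

lemma rotation_matrix_entries:
  fixes Q :: "real^3^3"
  assumes "rotation_matrix Q"
  shows "Q$2$2 * Q$3$3 - Q$2$3 * Q$3$2 = Q$1$1" "Q$2$3 * Q$3$1 - Q$2$1 * Q$3$3 = Q$1$2"
    "Q$2$1 * Q$3$2 - Q$2$2 * Q$3$1 = Q$1$3" "Q$3$2 * Q$1$3 - Q$3$3 * Q$1$2 = Q$2$1"
    "Q$3$3 * Q$1$1 - Q$3$1 * Q$1$3 = Q$2$2" "Q$3$1 * Q$1$2 - Q$3$2 * Q$1$1 = Q$2$3"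
    "Q$1$2 * Q$2$3 - Q$1$3 * Q$2$2 = Q$3$1" "Q$1$3 * Q$2$1 - Q$1$1 * Q$2$3 = Q$3$2"
    "Q$1$1 * Q$2$2 - Q$1$2 * Q$2$1 = Q$3$3"
  using cross_rotation_matrix[OF assms, of "axis 2 1" "axis 3 1"]
    cross_rotation_matrix[OF assms, of "axis 3 1" "axis 1 1"]
    cross_rotation_matrix[OF assms, of "axis 1 1" "axis 2 1"]
  by (simp_all add: vec_eq_iff forall_3 cross3_def matrix_vector_mult_def sum_3 axis_def algebra_simps)

text \<open>For a rotation by the angle s about the unit vector n, \<open>axial Q\<close> is 2
  sin(s) n and \<open>t\<close> is 2 (1 + cos(s)); both identities are then Rodrigues' formula. The
  proof derives them from orthogonality and the cofactor relations instead.\<close>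

lemma rotation_symmetric_part:
  fixes Q :: "real^3^3"
  assumes "rotation_matrix Q"
  defines "t \<equiv> 1 + trace Q"
  shows "axial Q \<bullet> axial Q = 4 * t - t\<^sup>2"
    and "outer (axial Q) (axial Q) = t *\<^sub>R (Q + transpose Q) - (t\<^sup>2 - 2 * t) *\<^sub>R mat 1"
proof -
  have "transpose Q ** Q = mat 1" "Q ** transpose Q = mat 1"
    using assms by (auto simp: rotation_matrix_def orthogonal_matrix_def)
  note this[unfolded vec_eq_iff forall_3 transpose_def matrix_matrix_mult_def sum_3 mat_def, simplified]
  note * = this rotation_matrix_entries[OF assms(1)]
  show "axial Q \<bullet> axial Q = 4 * t - t\<^sup>2"
    using * by (simp add: axial_def inner_vec_def sum_3 t_def trace_def) algebra
  show "outer (axial Q) (axial Q) = t *\<^sub>R (Q + transpose Q) - (t\<^sup>2 - 2 * t) *\<^sub>R mat 1"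
    using * unfolding vec_eq_iff forall_3
    apply (simp add: axial_def sum_3 t_def trace_def transpose_def mat_def)
    apply (intro conjI; algebra)
    done
qed

text \<open>For \<open>u = cayley_inv Q\<close> the denominator \<open>1 + u \<bullet> u\<close> is
  \<open>4 / t\<close>. The skew term yields half of \<open>Q - transpose Q\<close>, the outer
  product half of \<open>Q + transpose Q\<close>, and the multiples of the identity cancel.\<close>

lemma cayley_cayley_inv:
  assumes "rotation_matrix Q" "1 + trace Q \<noteq> 0"
  shows "cayley (cayley_inv Q) = Q"
proof -
  define t where "t = 1 + trace Q"
  define v where "v = axial Q"
  have t: "t \<noteq> 0" using assms by (simp add: t_def)
  have inv: "cayley_inv Q = inverse t *\<^sub>R v"
    by (simp add: cayley_inv_def t_def v_def)
  note sym = rotation_symmetric_part[OF assms(1), folded t_def v_def]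
  have q: "(inverse t *\<^sub>R v) \<bullet> (inverse t *\<^sub>R v) = 4 / t - 1"
    using t by (simp add: sym power2_eq_square field_simps)
  have o: "outer (inverse t *\<^sub>R v) (inverse t *\<^sub>R v)
      = (1 / t\<^sup>2) *\<^sub>R (t *\<^sub>R (Q + transpose Q) - (t\<^sup>2 - 2 * t) *\<^sub>R mat 1)"
    unfolding sym(2)[symmetric] by (simp add: vec_eq_iff power2_eq_square divide_inverse)
  have s: "skew (inverse t *\<^sub>R v) = inverse t *\<^sub>R (Q - transpose Q)"
    by (simp add: linear_cmul[OF bounded_linear.linear[OF bounded_linear_skew]] v_def skew_axial)
  show ?thesis
    unfolding inv cayley_def q o s using t
    by (simp add: vec_eq_iff power2_eq_square field_simps)
qed

lemma rotation_matrix_mult: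
  fixes P Q :: "real^'n^'n"
  shows "rotation_matrix P \<Longrightarrow> rotation_matrix Q \<Longrightarrow> rotation_matrix (P ** Q)"
  by (auto simp: rotation_matrix_def det_mul intro: orthogonal_matrix_mul)

lemma rotation_matrix_transpose: "rotation_matrix Q \<Longrightarrow> rotation_matrix (transpose Q)"
  by (simp add: rotation_matrix_def)

lemma orthogonal_matrix_cancel:
  fixes U :: "real^'n^'n"
  assumes "orthogonal_matrix U"
  shows "transpose U ** (U ** A) = A" "U ** (transpose U ** A) = A"
  using assms by (simp_all add: orthogonal_matrix_def matrix_mul_assoc)

lemma rotation_matrix_cancel:
  fixes R :: "real^'n^'n"
  assumes "rotation_matrix R"
  shows "transpose R ** (R ** A) = A" "R ** (transpose R ** A) = A"
  using assms by (simp_all add: rotation_matrix_def orthogonal_matrix_cancel)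

section \<open>Charts and tangent spaces of \<open>SO3\<close>\<close>

lemma smooth_on_cayley: "smooth_on cayley UNIV"
  unfolding smooth_on_def
proof
  fix k
  note add = Ck_on_add[OF open_UNIV] and lin = Ck_on_linear_compose[OF open_UNIV]
    and bil = Ck_on_bilinear[OF open_UNIV]
  have id: "Ck_on k (\<lambda>u::real^3. u) UNIV"
    by (rule Ck_on_bounded_linear[OF bounded_linear_ident])
  note u2 = bil[OF bounded_bilinear_inner id id]
  have a: "Ck_on k (\<lambda>u::real^3. 1 + u \<bullet> u) UNIV"
    by (intro add Ck_on_const u2)
  have b: "Ck_on k (\<lambda>u::real^3. inverse (1 + u \<bullet> u)) UNIV"
    by (intro Ck_on_inverse a open_UNIV less_imp_neq[THEN not_sym] one_plus_inner_pos)
  have c: "Ck_on k (\<lambda>u::real^3. 1 - u \<bullet> u) UNIV"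
    using add[OF Ck_on_const lin[OF bounded_linear_minus[OF bounded_linear_ident] u2]] by simp
  have "Ck_on k (\<lambda>u::real^3. (1 - u \<bullet> u) *\<^sub>R (mat 1 :: real^3^3) + 2 *\<^sub>R outer u u + 2 *\<^sub>R skew u) UNIV"
    by (intro add lin[OF bounded_linear_scaleR_right] lin[OF bounded_linear_skew]
        bil[OF bounded_bilinear_outer] bil[OF bounded_bilinear_scaleR] c id Ck_on_const)
  then show "Ck_on k cayley UNIV"
    unfolding cayley_def[abs_def] by (intro bil[OF bounded_bilinear_scaleR] b)
qed

lemma differentiable_cayley_inv:
  assumes "1 + trace Q \<noteq> 0"
  shows "cayley_inv differentiable (at Q)"
proof -
  have "(\<lambda>Q::real^3^3. 1 + trace Q) differentiable (at Q)"
    by (intro differentiable_add differentiable_const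
        bounded_linear_imp_differentiable[OF bounded_linear_trace])
  then have "(\<lambda>Q::real^3^3. inverse (1 + trace Q)) differentiable (at Q)"
    using assms by (rule differentiable_inverse)
  then show ?thesis
    unfolding cayley_inv_def[abs_def]
    by (intro differentiable_scaleR bounded_linear_imp_differentiable[OF bounded_linear_axial])
qed

text \<open>Left translation by \<open>R\<close> moves the Cayley chart so that 0 is sent to
  \<open>R\<close>. Its image consists of the rotations \<open>Q\<close> for which
  \<open>transpose R ** Q\<close> is not a half-turn, an open condition.\<close>

lemma local_param_cayley:
  assumes R: "rotation_matrix R"
  shows "local_param SO3 (UNIV :: (real^3) set) (\<lambda>u. R ** cayley u)"
proof -
  let ?\<phi> = "\<lambda>u. R ** cayley u" and ?\<psi> = "\<lambda>Q. cayley_inv (transpose R ** Q)"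
  note cancel = rotation_matrix_cancel[OF R]
  have linR: "bounded_linear (\<lambda>Q. R ** Q)" "bounded_linear (\<lambda>Q. transpose R ** Q)"
    for R :: "real^3^3"
    by (auto intro: bounded_bilinear.bounded_linear_right bounded_bilinear_matrix_matrix_mult)
  have smooth: "smooth_on ?\<phi> UNIV"
    using smooth_on_cayley unfolding smooth_on_def
    by (auto intro: Ck_on_linear_compose linR)
  have \<psi>\<phi>: "?\<psi> (?\<phi> u) = u" for u
    by (simp add: cancel cayley_inv_cayley)
  have tr: "1 + trace (transpose R ** ?\<phi> u) \<noteq> 0" for u
    using trace_cayley[of u] one_plus_inner_pos[of u] by (simp add: cancel)
  \<comment> \<open>\<open>T\<close> is open in the space of all matrices, so the inverse map can be
    differentiated in that space and not only along \<open>SO3\<close>.\<close>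
  define T where "T = {Q :: real^3^3. 1 + trace (transpose R ** Q) \<noteq> 0}"
  have img: "range ?\<phi> = SO3 \<inter> T"
  proof safe
    fix u show "?\<phi> u \<in> SO3" "?\<phi> u \<in> T"
      using rotation_cayley R tr by (simp_all add: SO3_def T_def rotation_matrix_mult)
  next
    fix Q assume "Q \<in> SO3" "Q \<in> T"
    then have "?\<phi> (?\<psi> Q) = Q"
      using R by (simp add: cayley_cayley_inv rotation_matrix_mult rotation_matrix_transpose
          SO3_def T_def cancel)
    then show "Q \<in> range ?\<phi>" by (metis rangeI)
  qed
  have \<phi>\<psi>: "?\<phi> (?\<psi> Q) = Q" if "Q \<in> range ?\<phi>" for Q
    using that by (auto simp: cancel cayley_inv_cayley)
  have "open T"
    unfolding T_def
    by (intro open_Collect_neq continuous_on_add continuous_on_const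
        bounded_linear.continuous_on[OF bounded_linear_trace] linear_continuous_on linR)
  then have op: "openin (top_of_set SO3) (range ?\<phi>)"
    unfolding img by (rule openin_open_Int)
  have d\<psi>: "?\<psi> differentiable (at Q)" if "Q \<in> T" for Q
  proof -
    have "cayley_inv \<circ> ((**) (transpose R)) differentiable (at Q)"
      by (rule differentiable_chain_at)
        (use that in \<open>auto intro!: bounded_linear_imp_differentiable linR differentiable_cayley_inv
          simp: T_def\<close>)
    then show ?thesis by (simp add: o_def)
  qed
  \<comment> \<open>The chain rule applied to the left inverse gives the derivative a left
    inverse.\<close>
  have "inj (frechet_derivative ?\<phi> (at u))" for u
  proof -
    have "(?\<phi> has_derivative frechet_derivative ?\<phi> (at u)) (at u)"
      by (rule smooth_on_derivative[OF smooth]) simp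
    moreover have "(?\<psi> has_derivative frechet_derivative ?\<psi> (at (?\<phi> u))) (at (?\<phi> u))"
      using d\<psi>[of "?\<phi> u"] tr by (simp add: frechet_derivative_works T_def)
    ultimately have "(?\<psi> \<circ> ?\<phi> has_derivative
        frechet_derivative ?\<psi> (at (?\<phi> u)) \<circ> frechet_derivative ?\<phi> (at u)) (at u)"
      by (rule diff_chain_at)
    moreover have "?\<psi> \<circ> ?\<phi> = id"
      using \<psi>\<phi> by auto
    ultimately have "frechet_derivative ?\<psi> (at (?\<phi> u)) \<circ> frechet_derivative ?\<phi> (at u) = id"
      using has_derivative_unique[OF _ has_derivative_id] by simp
    then show ?thesis
      by (intro inj_on_imageI2[of "frechet_derivative ?\<psi> (at (?\<phi> u))"]) (simp only: inj_on_id)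
  qed
  moreover have "homeomorphism UNIV (range ?\<phi>) ?\<phi> ?\<psi>"
  proof (rule homeomorphismI)
    show "continuous_on UNIV ?\<phi>"
      using smooth unfolding smooth_on_def by (metis Ck_on.simps(1))
    show "continuous_on (range ?\<phi>) ?\<psi>"
      using d\<psi> unfolding img
      by (intro differentiable_imp_continuous_on differentiable_at_imp_differentiable_on) auto
  qed (use \<psi>\<phi> \<phi>\<psi> in auto)
  ultimately show ?thesis
    using smooth op unfolding local_param_def by blast
qed

lemma embedded_submanifold_SO3: "embedded_submanifold TYPE(real^3) SO3"
  unfolding embedded_submanifold_def
proof
  fix Q assume "Q \<in> SO3"
  then have "local_param SO3 (UNIV :: (real^3) set) (\<lambda>u. Q ** cayley u)"
    by (intro local_param_cayley) (simp add: SO3_def)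
  moreover have "Q \<in> (\<lambda>u. Q ** cayley u) ` UNIV"
    by (rule image_eqI[of _ _ 0]) simp_all
  ultimately show "\<exists>(U :: (real^3) set) \<phi>. local_param SO3 U \<phi> \<and> Q \<in> \<phi> ` U"
    by blast
qed

lemma smooth_function_on_affine:
  fixes M :: "'a::euclidean_space set"
  assumes "bounded_linear L"
  shows "smooth_function_on (E :: 'e::euclidean_space itself) M (\<lambda>x. c + L x)"
  unfolding smooth_function_on_def smooth_on_def local_param_def o_def
  by (auto intro!: Ck_on_add Ck_on_const Ck_on_linear_compose[OF _ assms])

text \<open>Differentiating \<open>transpose (\<phi> u) ** \<phi> u = mat 1\<close> shows that
  \<open>transpose (\<phi> u)\<close> times the derivative is skew-symmetric. The resulting linear
  map is injective because the chart is an immersion, hence bijective as a map from a 3-dimensional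
  space to itself.\<close>

lemma SO3_tangent:
  fixes \<phi> :: "real^3 \<Rightarrow> real^3^3" and U :: "(real^3) set"
  assumes "local_param SO3 U \<phi>"
  shows "\<exists>L. \<forall>u\<in>U. linear (L u) \<and> bij (L u) \<and>
    (\<forall>h. frechet_derivative \<phi> (at u) h = \<phi> u ** skew (L u h))"
proof -
  have U: "open U" and smooth: "smooth_on \<phi> U"
    and inj: "\<And>u. u \<in> U \<Longrightarrow> inj (frechet_derivative \<phi> (at u))"
    and "openin (top_of_set SO3) (\<phi> ` U)"
    using assms by (auto simp: local_param_def)
  then have rot: "rotation_matrix (\<phi> u)" if "u \<in> U" for u
    using that openin_imp_subset unfolding SO3_def by blast
  define D where "D u = frechet_derivative \<phi> (at u)" for u
  have D: "(\<phi> has_derivative D u) (at u)" if "u \<in> U" for u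
    unfolding D_def by (rule smooth_on_derivative[OF smooth that])
  \<comment> \<open>The factor 1/2 compensates for the doubling in \<open>axial\<close>.\<close>
  define L where "L u h = (1/2) *\<^sub>R axial (transpose (\<phi> u) ** D u h)" for u h
  have eq: "frechet_derivative \<phi> (at u) h = \<phi> u ** skew (L u h)" if u: "u \<in> U" for u h
  proof -
    have tr: "((\<lambda>v. transpose (\<phi> v)) has_derivative (\<lambda>h. transpose (D u h))) (at u)"
      by (rule bounded_linear.has_derivative[OF bounded_linear_transpose D[OF u]])
    have "((\<lambda>v. transpose (\<phi> v) ** \<phi> v) has_derivative
        (\<lambda>h. transpose (\<phi> u) ** D u h + transpose (D u h) ** \<phi> u)) (at u)"
      by (rule bounded_bilinear.FDERIV[OF bounded_bilinear_matrix_matrix_mult tr D[OF u]])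
    moreover have "((\<lambda>v. transpose (\<phi> v) ** \<phi> v) has_derivative (\<lambda>h. 0)) (at u)"
      by (rule has_derivative_transform_within_open[OF has_derivative_const U u, of "mat 1"])
        (use rot in \<open>auto simp: rotation_matrix_def orthogonal_matrix\<close>)
    ultimately have "transpose (\<phi> u) ** D u h + transpose (D u h) ** \<phi> u = 0"
      using fun_cong[OF has_derivative_unique] by blast
    then have "transpose (transpose (\<phi> u) ** D u h) = - (transpose (\<phi> u) ** D u h)"
      by (simp add: matrix_transpose_mul eq_neg_iff_add_eq_0 add.commute)
    from skew_symmetric_eq_skew[OF this] have "transpose (\<phi> u) ** D u h = skew (L u h)"
      by (simp add: L_def)
    then show ?thesis
      using rotation_matrix_cancel(2)[OF rot[OF u], of "D u h"] by (simp add: D_def)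
  qed
  have lin: "linear (L u)" if u: "u \<in> U" for u
  proof -
    have "bounded_linear (D u)"
      using D[OF u] by (rule has_derivative_bounded_linear)
    then have "linear ((\<lambda>A. (1/2) *\<^sub>R axial (transpose (\<phi> u) ** A)) \<circ> D u)"
      by (intro linear_compose[of "D u"] bounded_linear.linear[of "D u"]
          bounded_linear.linear[of "\<lambda>A. (1/2) *\<^sub>R axial (transpose (\<phi> u) ** A)"] bounded_linear_const_scaleR
          bounded_linear_compose[OF bounded_linear_axial]
          bounded_bilinear.bounded_linear_right[OF bounded_bilinear_matrix_matrix_mult])
    then show ?thesis by (simp add: o_def L_def[abs_def])
  qed
  have "bij (L u)" if u: "u \<in> U" for u
  proof -
    have "inj (L u)"
      using inj[OF u] unfolding inj_on_def eq[OF u] by auto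
    then show ?thesis
      using lin[OF u] linear_injective_imp_surjective by (auto simp: bij_def)
  qed
  with eq lin show ?thesis by blast
qed

section \<open>Critical points and Hessian\<close>

lemma trace_inner_mat_diff: "trace_inner (mat 1 - Q) K = trace K - Q \<bullet> K"
  by (simp add: trace_inner_eq_inner inner_diff_left)
    (simp add: trace_inner_eq_inner[symmetric] trace_inner_def)

text \<open>Transposition preserves the inner product, fixes \<open>S\<close> and negates
  \<open>A\<close>, so the pairing equals its own negative.\<close>

lemma inner_skew_part_symmetric:
  fixes A S :: "real^'n^'n"
  assumes "A + transpose A = 0" "transpose S = S"
  shows "A \<bullet> S = 0"
proof -
  have "A \<bullet> S = transpose A \<bullet> S"
    using inner_transpose[of A S] assms(2) by simp
  moreover have "A \<bullet> S + transpose A \<bullet> S = 0"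
    using assms(1) by (simp add: inner_add_left[symmetric])
  ultimately show ?thesis by simp
qed

lemma outer_inner: "outer a b \<bullet> S = a \<bullet> (S *v b)"
  by (simp add: inner_vec_def matrix_vector_mult_def sum_distrib_left mult_ac)

lemma inner_rotation_cancel:
  fixes Q :: "real^'n^'n"
  assumes "rotation_matrix Q"
  shows "(transpose Q ** A) \<bullet> (transpose Q ** B) = A \<bullet> B"
  by (simp add: inner_matrix_mult_left rotation_matrix_cancel[OF assms])

lemma local_param_SO3_rotation:
  assumes "local_param SO3 U \<phi>" "u \<in> U"
  shows "rotation_matrix (\<phi> u)"
  using assms openin_imp_subset unfolding local_param_def SO3_def by blast

lemma has_derivative_cost:
  fixes \<phi> :: "real^3 \<Rightarrow> real^3^3"
  assumes "local_param SO3 U \<phi>" "u \<in> U"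
  shows "(((\<lambda>Q. trace_inner (mat 1 - Q) K) \<circ> \<phi>) has_derivative
      (\<lambda>h. - (frechet_derivative \<phi> (at u) h \<bullet> K))) (at u)"
proof -
  have D: "(\<phi> has_derivative frechet_derivative \<phi> (at u)) (at u)"
    using assms smooth_on_derivative by (auto simp: local_param_def)
  have "((\<lambda>u. trace K - \<phi> u \<bullet> K) has_derivative
      (\<lambda>h. 0 - frechet_derivative \<phi> (at u) h \<bullet> K)) (at u)"
    by (intro has_derivative_diff has_derivative_const has_derivative_inner_left D)
  then show ?thesis
    by (simp add: o_def trace_inner_mat_diff)
qed

text \<open>The derivative in direction \<open>h\<close> is minus the pairing of
  \<open>skew (L u h)\<close> with \<open>transpose (\<phi> u) ** K\<close>. As \<open>L u\<close>
  is onto, it vanishes exactly when that matrix is orthogonal to all skew-symmetric ones.\<close>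

lemma critical_chart_iff:
  fixes \<phi> :: "real^3 \<Rightarrow> real^3^3"
  assumes "local_param SO3 U \<phi>" "u \<in> U"
  shows "(((\<lambda>Q. trace_inner (mat 1 - Q) K) \<circ> \<phi>) has_derivative (\<lambda>_. 0)) (at u) \<longleftrightarrow>
    transpose (transpose (\<phi> u) ** K) = transpose (\<phi> u) ** K"
proof -
  from SO3_tangent[OF assms(1)] obtain L where L:
    "\<And>u h. u \<in> U \<Longrightarrow> frechet_derivative \<phi> (at u) h = \<phi> u ** skew (L u h)"
    "\<And>u. u \<in> U \<Longrightarrow> bij (L u)" "\<And>u. u \<in> U \<Longrightarrow> linear (L u)"
    by blast
  note D = has_derivative_cost[OF assms, of K]
  have "(((\<lambda>Q. trace_inner (mat 1 - Q) K) \<circ> \<phi>) has_derivative (\<lambda>_. 0)) (at u) \<longleftrightarrow>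
      (\<lambda>h. - (frechet_derivative \<phi> (at u) h \<bullet> K)) = (\<lambda>_. 0)"
  proof
    assume "(\<lambda>h. - (frechet_derivative \<phi> (at u) h \<bullet> K)) = (\<lambda>_. 0)"
    with D show "(((\<lambda>Q. trace_inner (mat 1 - Q) K) \<circ> \<phi>) has_derivative (\<lambda>_. 0)) (at u)"
      by (simp only:)
  qed (rule has_derivative_unique[OF D])
  also have "\<dots> \<longleftrightarrow> (\<forall>h. skew (L u h) \<bullet> (transpose (\<phi> u) ** K) = 0)"
    by (simp add: fun_eq_iff L(1)[OF assms(2)] inner_matrix_mult_left)
  also have "\<dots> \<longleftrightarrow> (\<forall>w. skew w \<bullet> (transpose (\<phi> u) ** K) = 0)"
    using bij_is_surj[OF L(2)[OF assms(2)]] by (metis surjD)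
  finally show ?thesis
    by (simp only: inner_skew_symmetric)
qed

text \<open>The chartwise condition involves only the point \<open>Q\<close>. For the converse the
  Cayley chart translated by \<open>Q\<close> is used, with \<open>Q\<close> at parameter 0.\<close>

lemma critical_point_SO3_iff:
  "critical_point TYPE(real^3) SO3 (\<lambda>Q. trace_inner (mat 1 - Q) K) Q \<longleftrightarrow>
    rotation_matrix Q \<and> transpose (transpose Q ** K) = transpose Q ** K"
proof
  assume "critical_point TYPE(real^3) SO3 (\<lambda>Q. trace_inner (mat 1 - Q) K) Q"
  then obtain U :: "(real^3) set" and \<phi> u where "local_param SO3 U \<phi>" "u \<in> U" "\<phi> u = Q"
    "(((\<lambda>Q. trace_inner (mat 1 - Q) K) \<circ> \<phi>) has_derivative (\<lambda>_. 0)) (at u)"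
    unfolding critical_point_def by blast
  then show "rotation_matrix Q \<and> transpose (transpose Q ** K) = transpose Q ** K"
    using critical_chart_iff local_param_SO3_rotation by metis
next
  assume Q: "rotation_matrix Q \<and> transpose (transpose Q ** K) = transpose Q ** K"
  then have chart: "local_param SO3 (UNIV :: (real^3) set) (\<lambda>u. Q ** cayley u)"
    by (intro local_param_cayley) simp
  have "(((\<lambda>Q. trace_inner (mat 1 - Q) K) \<circ> (\<lambda>u. Q ** cayley u)) has_derivative (\<lambda>_. 0)) (at 0)"
    using Q by (subst critical_chart_iff[OF chart UNIV_I]) simp
  then show "critical_point TYPE(real^3) SO3 (\<lambda>Q. trace_inner (mat 1 - Q) K) Q"
    unfolding critical_point_def using chart
    by (intro exI[of _ UNIV] exI[of _ "\<lambda>u. Q ** cayley u"] exI[of _ 0]) simp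
qed

text \<open>Differentiating \<open>\<phi>\<^sup>T \<partial>\<^sub>h\<phi> \<in> so(3)\<close> shows that \<open>\<phi>\<^sup>T \<partial>\<^sub>k\<partial>\<^sub>h\<phi> + (\<partial>\<^sub>k\<phi>)\<^sup>T \<partial>\<^sub>h\<phi>\<close> is skew-symmetric,
  hence orthogonal to the symmetric matrix \<open>\<phi>\<^sup>T K\<close>. This eliminates the second derivatives of \<open>\<phi>\<close>.\<close>

lemma hessian_cost:
  fixes \<phi> :: "real^3 \<Rightarrow> real^3^3"
  assumes chart: "local_param SO3 U \<phi>" and u: "u \<in> U"
    and S: "S = transpose (\<phi> u) ** K" "transpose S = S"
  shows "\<exists>L. linear L \<and> bij L \<and> (\<forall>h k. hessian ((\<lambda>Q. trace_inner (mat 1 - Q) K) \<circ> \<phi>) u h k =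
    (L k \<bullet> L h) * trace S - L h \<bullet> (S *v L k))"
proof -
  have U: "open U" and smooth: "smooth_on \<phi> U"
    using chart by (auto simp: local_param_def)
  note rot = local_param_SO3_rotation[OF chart u]
  from SO3_tangent[OF chart] obtain L where L:
    "\<And>u h. u \<in> U \<Longrightarrow> frechet_derivative \<phi> (at u) h = \<phi> u ** skew (L u h)"
    "\<And>u. u \<in> U \<Longrightarrow> bij (L u)" "\<And>u. u \<in> U \<Longrightarrow> linear (L u)"
    by blast
  define D where "D v h = frechet_derivative \<phi> (at v) h" for v h
  have D: "(\<phi> has_derivative D u) (at u)"
    unfolding D_def by (rule smooth_on_derivative[OF smooth u])
  have "hessian ((\<lambda>Q. trace_inner (mat 1 - Q) K) \<circ> \<phi>) u h k =
      (L u k \<bullet> L u h) * trace S - L u h \<bullet> (S *v L u k)" for h k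
  proof -
    define G' where "G' = frechet_derivative (\<lambda>v. D v h) (at u)"
    have G': "((\<lambda>v. D v h) has_derivative G') (at u)"
      unfolding D_def G'_def
      by (rule smooth_on_derivative[OF smooth_on_frechet_derivative[OF smooth] u])
    have "((\<lambda>v. - (D v h \<bullet> K)) has_derivative (\<lambda>k. - (G' k \<bullet> K))) (at u)"
      by (intro has_derivative_minus has_derivative_inner_left G')
    then have "((\<lambda>v. frechet_derivative ((\<lambda>Q. trace_inner (mat 1 - Q) K) \<circ> \<phi>) (at v) h)
        has_derivative (\<lambda>k. - (G' k \<bullet> K))) (at u)"
      by (rule has_derivative_transform_within_open[OF _ U u])
        (simp add: D_def frechet_derivative_at[OF has_derivative_cost[OF chart], symmetric])
    then have hess: "hessian ((\<lambda>Q. trace_inner (mat 1 - Q) K) \<circ> \<phi>) u h k = - (G' k \<bullet> K)"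
      unfolding hessian_def using frechet_derivative_at by metis
    define M where "M k = transpose (\<phi> u) ** G' k + transpose (D u k) ** D u h" for k
    have tr: "((\<lambda>v. transpose (\<phi> v)) has_derivative (\<lambda>k. transpose (D u k))) (at u)"
      by (rule bounded_linear.has_derivative[OF bounded_linear_transpose D])
    have M: "((\<lambda>v. transpose (\<phi> v) ** D v h) has_derivative M) (at u)"
      unfolding M_def
      by (rule bounded_bilinear.FDERIV[OF bounded_bilinear_matrix_matrix_mult tr G'])
    have "((\<lambda>v. transpose (\<phi> v) ** D v h + transpose (transpose (\<phi> v) ** D v h))
        has_derivative (\<lambda>k. M k + transpose (M k))) (at u)"
      by (intro has_derivative_add M bounded_linear.has_derivative[OF bounded_linear_transpose])
    moreover have "((\<lambda>v. transpose (\<phi> v) ** D v h + transpose (transpose (\<phi> v) ** D v h))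
        has_derivative (\<lambda>k. 0)) (at u)"
      by (rule has_derivative_transform_within_open[OF has_derivative_const U u, of 0])
        (simp add: D_def L(1) rotation_matrix_cancel local_param_SO3_rotation[OF chart]
          transpose_skew)
    ultimately have "M k + transpose (M k) = 0"
      using fun_cong[OF has_derivative_unique] by blast
    then have "M k \<bullet> S = 0"
      using S(2) by (rule inner_skew_part_symmetric)
    moreover have "(transpose (\<phi> u) ** G' k) \<bullet> S = G' k \<bullet> K"
      unfolding S by (rule inner_rotation_cancel[OF rot])
    moreover have "transpose (D u k) ** D u h = transpose (skew (L u k)) ** skew (L u h)"
      by (simp add: D_def L(1)[OF u] matrix_transpose_mul matrix_mul_assoc[symmetric]
          rotation_matrix_cancel[OF rot])
    ultimately have "- (G' k \<bullet> K) = (transpose (skew (L u k)) ** skew (L u h)) \<bullet> S"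
      by (simp add: M_def inner_add_left)
    also have "\<dots> = (L u k \<bullet> L u h) * (mat 1 \<bullet> S) - L u h \<bullet> (S *v L u k)"
      by (simp add: transpose_skew_mult_skew inner_diff_left outer_inner)
    also have "mat 1 \<bullet> S = trace S"
      by (simp add: trace_inner_eq_inner[symmetric] trace_inner_def)
    finally show ?thesis
      by (simp only: hess)
  qed
  then show ?thesis
    using L(2,3)[OF u] by blast
qed

text \<open>With \<open>S = transpose Q ** K\<close>, the Hessian pairs \<open>L k\<close> with
  \<open>trace S *\<^sub>R L h - S *v L h\<close>. Nondegeneracy thus reduces to the trace of
  \<open>S\<close> not being an eigenvalue of \<open>S\<close>.\<close>

lemma morse_function_cost:
  assumes "\<And>Q x. \<lbrakk>rotation_matrix Q; transpose (transpose Q ** K) = transpose Q ** K;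
      (transpose Q ** K) *v x = trace (transpose Q ** K) *\<^sub>R x\<rbrakk> \<Longrightarrow> x = 0"
  shows "morse_function_on TYPE(real^3) SO3 (\<lambda>Q. trace_inner (mat 1 - Q) K)"
  unfolding morse_function_on_def nondegenerate_critical_point_def
proof (intro conjI allI impI; (elim conjE)?)
  show "embedded_submanifold TYPE(real^3) SO3"
    by (rule embedded_submanifold_SO3)
  have "smooth_function_on TYPE(real^3) SO3 (\<lambda>Q. trace K + - (Q \<bullet> K))"
    by (intro smooth_function_on_affine bounded_linear_minus bounded_linear_inner_left)
  then show "smooth_function_on TYPE(real^3) SO3 (\<lambda>Q. trace_inner (mat 1 - Q) K)"
    by (simp add: trace_inner_mat_diff)
next
  fix Q and U :: "(real^3) set" and \<phi> u h
  assume crit: "critical_point TYPE(real^3) SO3 (\<lambda>Q. trace_inner (mat 1 - Q) K) Q"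
    and chart: "local_param SO3 U \<phi>" "u \<in> U" "\<phi> u = Q"
    and hess: "\<forall>k. hessian ((\<lambda>Q. trace_inner (mat 1 - Q) K) \<circ> \<phi>) u h k = 0"
  define S where "S = transpose Q ** K"
  have Q: "rotation_matrix Q" "transpose S = S"
    using crit by (simp_all add: critical_point_SO3_iff S_def)
  with hessian_cost[OF chart(1,2), of S K] obtain L where L: "linear L" "bij L"
    "\<And>k. (L k \<bullet> L h) * trace S - L h \<bullet> (S *v L k) = 0"
    using hess chart(3) unfolding S_def by auto
  \<comment> \<open>Surjectivity of \<open>L\<close> extends the vanishing from the vectors
    \<open>L k\<close> to all \<open>w\<close>; symmetry of \<open>S\<close> moves it to the other
    argument.\<close>
  have "w \<bullet> (S *v L h - trace S *\<^sub>R L h) = 0" for w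
  proof -
    obtain k where "w = L k" using L(2) by (metis bij_pointE)
    moreover have "L h \<bullet> (S *v L k) = (S *v L h) \<bullet> L k"
      using dot_lmul_matrix[of "L h" S "L k"] Q(2) transpose_matrix_vector[of S "L h"] by simp
    ultimately show ?thesis
      using L(3)[of k] by (simp add: inner_diff_right inner_commute mult.commute)
  qed
  then have "S *v L h - trace S *\<^sub>R L h = 0"
    by (metis inner_eq_zero_iff)
  then have "L h = 0"
    using assms Q unfolding S_def by auto
  then show "h = 0"
    using L linear_0[OF L(1)] by (metis bij_pointE)
qed

section \<open>Critical points in the eigenbasis of \<open>K\<close>\<close>

text \<open>If \<open>Y\<^sup>T D\<close> is symmetric and \<open>Y\<close> orthogonal, then \<open>Y D Y = D\<close>, so \<open>Y\<close> commutes with \<open>D\<^sup>2\<close>,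
  whose eigenvalues are distinct.\<close>

lemma orthogonal_symmetric_diag_iff:
  fixes Y :: "real^'n^'n"
  assumes Y: "orthogonal_matrix Y" and d: "\<And>i. 0 < d $ i"
    and distinct: "\<And>i j. i \<noteq> j \<Longrightarrow> d $ i \<noteq> d $ j"
  shows "transpose (transpose Y ** diag_matrix d) = transpose Y ** diag_matrix d \<longleftrightarrow>
    (\<exists>e. (\<forall>i. (e $ i)\<^sup>2 = 1) \<and> Y = diag_matrix e)"
proof
  let ?D = "diag_matrix d"
  assume "transpose (transpose Y ** ?D) = transpose Y ** ?D"
  then have sym: "?D ** Y = transpose Y ** ?D"
    by (simp add: matrix_transpose_mul)
  have YDY: "Y ** ?D ** Y = ?D"
    using Y by (simp add: matrix_mul_assoc[symmetric] sym)
      (simp add: matrix_mul_assoc orthogonal_matrix_def)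
  have "Y ** (?D ** ?D) = Y ** ?D ** (Y ** ?D ** Y)"
    unfolding YDY by (simp only: matrix_mul_assoc)
  also have "\<dots> = Y ** ?D ** Y ** ?D ** Y"
    by (simp only: matrix_mul_assoc)
  also have "\<dots> = ?D ** ?D ** Y"
    unfolding YDY ..
  finally have comm: "Y ** (?D ** ?D) = ?D ** ?D ** Y" .
  have off: "Y $ i $ j = 0" if "i \<noteq> j" for i j
  proof -
    have "(Y ** (?D ** ?D)) $ i $ j = (?D ** ?D ** Y) $ i $ j"
      by (simp only: comm)
    then have "Y $ i $ j * (d $ j)\<^sup>2 = (d $ i)\<^sup>2 * Y $ i $ j"
      by (simp add: diag_matrix_mult power2_eq_square)
    \<comment> \<open>Positivity excludes \<open>d $ i = - d $ j\<close>, so distinct entries have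
      distinct squares.\<close>
    moreover have "(d $ i)\<^sup>2 \<noteq> (d $ j)\<^sup>2"
      using distinct[OF that] d[of i] d[of j] by (auto simp: power2_eq_iff)
    ultimately show ?thesis by (auto simp: mult.commute)
  qed
  define e :: "real^'n" where "e = (\<chi> i. Y $ i $ i)"
  have Ye: "Y = diag_matrix e"
    using off by (auto simp: vec_eq_iff diag_matrix_def e_def)
  have "diag_matrix (\<chi> i. e $ i * e $ i) = mat 1"
    using Y by (simp add: orthogonal_matrix Ye diag_matrix_mult)
  then have "diag_matrix (\<chi> i. e $ i * e $ i) $ i $ i = (mat 1 :: real^'n^'n) $ i $ i" for i
    by (simp only:)
  then have "(e $ i)\<^sup>2 = 1" for i
    by (simp add: diag_matrix_def mat_def power2_eq_square)
  with Ye show "\<exists>e. (\<forall>i. (e $ i)\<^sup>2 = 1) \<and> Y = diag_matrix e" by blast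
next
  assume "\<exists>e. (\<forall>i. (e $ i)\<^sup>2 = 1) \<and> Y = diag_matrix e"
  then show "transpose (transpose Y ** diag_matrix d) = transpose Y ** diag_matrix d"
    by (auto simp: diag_matrix_mult)
qed

text \<open>The product is 1 exactly when the number of minus signs is even, that is, zero or two;
  two minus signs leave one position \<open>i\<close> with a plus.\<close>

lemma sign_vectors_3:
  "{e :: real^3. (\<forall>i. (e $ i)\<^sup>2 = 1) \<and> prod (($) e) UNIV = 1} =
    insert (\<chi> i. 1) (range (\<lambda>i. \<chi> j. if j = i then 1 else - 1))"
proof -
  have prod: "prod (($) e) UNIV = e $ 1 * e $ 2 * e $ 3" for e :: "real^3"
    unfolding UNIV_3 by simp
  have "(\<forall>i. (e $ i)\<^sup>2 = 1) \<and> prod (($) e) UNIV = 1 \<longleftrightarrow>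
      e = (\<chi> i. 1) \<or> (\<exists>i. e = (\<chi> j. if j = i then 1 else - 1))" for e :: "real^3"
  proof -
    have "(\<exists>i. e = (\<chi> j. if j = i then 1 else - 1)) \<longleftrightarrow> e = (\<chi> j. if j = 1 then 1 else - 1) \<or>
        e = (\<chi> j. if j = 2 then 1 else - 1) \<or> e = (\<chi> j. if j = 3 then 1 else - 1)"
      by (metis exhaust_3)
    also have "\<dots> \<longleftrightarrow> e $ 1 = 1 \<and> e $ 2 = -1 \<and> e $ 3 = -1 \<or> e $ 1 = -1 \<and> e $ 2 = 1 \<and> e $ 3 = -1
        \<or> e $ 1 = -1 \<and> e $ 2 = -1 \<and> e $ 3 = 1"
      by (simp add: vec_eq_iff forall_3)
    finally have ex: "(\<exists>i. e = (\<chi> j. if j = i then 1 else - 1)) \<longleftrightarrow> \<dots>" .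
    show ?thesis
      unfolding prod ex by (simp only: vec_eq_iff forall_3 power2_eq_1_iff vec_lambda_beta) auto
  qed
  then show ?thesis by blast
qed

text \<open>Coordinate \<open>i\<close> of the equation says that \<open>x $ i\<close> times the sum
  of the other two numbers \<open>e $ j * d $ j\<close> is zero. That sum is nonzero because the two
  have different absolute values.\<close>

lemma trace_diag_eigenvector_zero:
  fixes d e x :: "real^3"
  assumes d: "\<And>i. 0 < d $ i" and distinct: "\<And>i j. i \<noteq> j \<Longrightarrow> d $ i \<noteq> d $ j"
    and e: "\<And>i. (e $ i)\<^sup>2 = 1" and x: "\<And>i. e $ i * d $ i * x $ i = (\<Sum>j\<in>UNIV. e $ j * d $ j) * x $ i"
  shows "x = 0"
proof -
  have ne: "e $ i * d $ i + e $ j * d $ j \<noteq> 0" if "i \<noteq> j" for i j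
  proof
    assume "e $ i * d $ i + e $ j * d $ j = 0"
    then have "(e $ i * d $ i)\<^sup>2 = (e $ j * d $ j)\<^sup>2"
      by (metis add_eq_0_iff power2_minus)
    then show False
      using distinct[OF that] d[of i] d[of j] by (simp add: power_mult_distrib e)
  qed
  have "(e $ 2 * d $ 2 + e $ 3 * d $ 3) * x $ 1 = 0" "(e $ 1 * d $ 1 + e $ 3 * d $ 3) * x $ 2 = 0"
    "(e $ 1 * d $ 1 + e $ 2 * d $ 2) * x $ 3 = 0"
    using x[of 1] x[of 2] x[of 3] by (simp_all add: sum_3 algebra_simps)
  then show ?thesis
    using ne[of 1 2] ne[of 1 3] ne[of 2 3] by (simp add: vec_eq_iff forall_3)
qed

text \<open>Conjugation by \<open>U\<close> replaces \<open>K\<close> by a diagonal matrix and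
  \<open>Q\<close> by \<open>Y\<close>, preserving orthogonality, determinant and the symmetry
  condition. What remains is the diagonal case, where determinant 1 is a condition on the product of
  the signs.\<close>

lemma rotation_symmetric_conj_iff:
  fixes Q U :: "real^3^3"
  assumes U: "orthogonal_matrix U" and d: "\<And>i. 0 < d $ i"
    and distinct: "\<And>i j. i \<noteq> j \<Longrightarrow> d $ i \<noteq> d $ j"
    and K: "K = U ** diag_matrix d ** transpose U"
  shows "rotation_matrix Q \<and> transpose (transpose Q ** K) = transpose Q ** K \<longleftrightarrow>
    (\<exists>e. (\<forall>i. (e $ i)\<^sup>2 = 1) \<and> prod (($) e) UNIV = 1 \<and> Q = U ** diag_matrix e ** transpose U)"
proof -
  define Y where "Y = transpose U ** Q ** U"
  have UU: "transpose U ** U = mat 1" "U ** transpose U = mat 1"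
    using U by (simp_all add: orthogonal_matrix_def)
  note cancel = orthogonal_matrix_cancel[OF U]
  have Q: "Q = U ** A ** transpose U \<longleftrightarrow> Y = A" for A
  proof
    assume "Q = U ** A ** transpose U"
    then show "Y = A" by (simp add: Y_def matrix_mul_assoc[symmetric] cancel UU)
  next
    assume "Y = A"
    then show "Q = U ** A ** transpose U"
      by (auto simp: Y_def matrix_mul_assoc[symmetric] cancel UU)
  qed
  have QY: "Q = U ** Y ** transpose U"
    by (simp add: Q)
  \<comment> \<open>\<open>U\<close> may have determinant -1; conjugation involves only the
    square.\<close>
  have detU: "det U * det U = 1"
    using UU(1) by (metis det_I det_mul det_transpose)
  have orth: "orthogonal_matrix Q \<longleftrightarrow> orthogonal_matrix Y"
  proof
    assume "orthogonal_matrix Q"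
    then show "orthogonal_matrix Y"
      unfolding Y_def using U by (simp add: orthogonal_matrix_mul)
  next
    assume "orthogonal_matrix Y"
    then show "orthogonal_matrix Q"
      using U by (subst QY) (simp add: orthogonal_matrix_mul)
  qed
  have det: "det Y = det Q"
    unfolding Y_def using detU by (simp add: det_mul mult_ac)
  have S: "transpose Q ** K = U ** (transpose Y ** diag_matrix d) ** transpose U"
    by (simp add: K QY matrix_transpose_mul matrix_mul_assoc[symmetric] cancel)
  have conj: "transpose (U ** A ** transpose U) = U ** transpose A ** transpose U" for A
    by (simp add: matrix_transpose_mul matrix_mul_assoc)
  have "transpose (transpose Q ** K) = transpose Q ** K \<longleftrightarrow>
      transpose (transpose Y ** diag_matrix d) = transpose Y ** diag_matrix d"
  proof
    assume "transpose (transpose Q ** K) = transpose Q ** K"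
    then have "transpose U ** transpose (transpose Q ** K) ** U = transpose U ** (transpose Q ** K) ** U"
      by simp
    then show "transpose (transpose Y ** diag_matrix d) = transpose Y ** diag_matrix d"
      by (simp add: S matrix_transpose_mul matrix_mul_assoc[symmetric] cancel UU)
  next
    assume "transpose (transpose Y ** diag_matrix d) = transpose Y ** diag_matrix d"
    then show "transpose (transpose Q ** K) = transpose Q ** K"
      unfolding S by (simp only: conj)
  qed
  then have "rotation_matrix Q \<and> transpose (transpose Q ** K) = transpose Q ** K \<longleftrightarrow>
      det Y = 1 \<and> orthogonal_matrix Y \<and>
      transpose (transpose Y ** diag_matrix d) = transpose Y ** diag_matrix d"
    by (auto simp: rotation_matrix_def orth det)
  also have "\<dots> \<longleftrightarrow> det Y = 1 \<and> orthogonal_matrix Y \<and> (\<exists>e. (\<forall>i. (e $ i)\<^sup>2 = 1) \<and> Y = diag_matrix e)"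
    using orthogonal_symmetric_diag_iff[of Y d, OF _ d distinct] by blast
  also have "\<dots> \<longleftrightarrow> (\<exists>e. (\<forall>i. (e $ i)\<^sup>2 = 1) \<and> det Y = 1 \<and> Y = diag_matrix e)"
  proof -
    have "orthogonal_matrix (diag_matrix e)" if "\<forall>i. (e $ i)\<^sup>2 = 1" for e :: "real^3"
      using that by (simp add: orthogonal_matrix diag_matrix_mult power2_eq_square diag_matrix_1)
    then show ?thesis by blast
  qed
  also have "\<dots> \<longleftrightarrow> (\<exists>e. (\<forall>i. (e $ i)\<^sup>2 = 1) \<and> prod (($) e) UNIV = 1 \<and> Y = diag_matrix e)"
    by (rule ex_cong1) (metis det_diag_matrix)
  finally show ?thesis
    unfolding Q .
qed

text \<open>The projection onto the \<open>i\<close>th axis has the single entry 1 at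
  \<open>i\<close>, so doubling it and subtracting the identity leaves 1 at \<open>i\<close> and -1
  elsewhere. Conjugating by \<open>U\<close> keeps the identity fixed. For size 3 this is the
  half-turn about column \<open>i\<close> of \<open>U\<close>.\<close>

lemma half_turn_diag:
  fixes U :: "real^'n^'n"
  assumes "orthogonal_matrix U"
  defines "a \<equiv> \<lambda>i. column i (mat 1 :: real^'n^'n)"
  shows "2 *\<^sub>R (U ** ((columnvector (a i) :: real^1^'n) ** transpose (columnvector (a i))) ** transpose U) - mat 1
    = U ** diag_matrix (\<chi> j. if j = i then 1 else - 1) ** transpose U"
proof -
  have a: "(columnvector (a i) :: real^1^'n) ** transpose (columnvector (a i)) = diag_matrix (axis i 1)"
    by (simp add: vec_eq_iff matrix_matrix_mult_def sum_1 columnvector_def transpose_def a_def column_def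
        mat_def diag_matrix_def axis_def)
  have "diag_matrix (\<chi> j. if j = i then 1 else - 1) = 2 *\<^sub>R diag_matrix (axis i 1) - (mat 1 :: real^'n^'n)"
    by (simp add: vec_eq_iff diag_matrix_def axis_def mat_def)
  moreover have "U ** (2 *\<^sub>R A - mat 1) ** transpose U = 2 *\<^sub>R (U ** A ** transpose U) - mat 1" for A
    using assms(1)
    by (simp add: orthogonal_matrix_def scalar_matrix_assoc matrix_scalar_ac
        bounded_bilinear.diff_right[OF bounded_bilinear_matrix_matrix_mult]
        bounded_bilinear.diff_left[OF bounded_bilinear_matrix_matrix_mult])
  ultimately show ?thesis
    by (simp only: a)
qed

text \<open>Supplies the eigenvalue condition for the Morse property: in the basis given by
  \<open>U\<close>, the matrix \<open>transpose Q ** K\<close> is diagonal with entries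
  \<open>e $ i * d $ i\<close>.\<close>

lemma rotation_symmetric_trace_eigenvector:
  fixes Q U :: "real^3^3"
  assumes U: "orthogonal_matrix U" and d: "\<And>i. 0 < d $ i"
    and distinct: "\<And>i j. i \<noteq> j \<Longrightarrow> d $ i \<noteq> d $ j"
    and K: "K = U ** diag_matrix d ** transpose U"
    and Q: "rotation_matrix Q" "transpose (transpose Q ** K) = transpose Q ** K"
    and x: "(transpose Q ** K) *v x = trace (transpose Q ** K) *\<^sub>R x"
  shows "x = 0"
proof -
  obtain e where e: "\<And>i. (e $ i)\<^sup>2 = 1" and Qe: "Q = U ** diag_matrix e ** transpose U"
    using rotation_symmetric_conj_iff[OF U d distinct K, of Q] Q by auto
  define g where "g = (\<chi> i. e $ i * d $ i)"
  have UU: "transpose U ** U = mat 1" "U ** transpose U = mat 1"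
    using U by (simp_all add: orthogonal_matrix_def)
  have "transpose Q ** K = U ** (diag_matrix e ** ((transpose U ** U) ** (diag_matrix d ** transpose U)))"
    by (simp only: K Qe matrix_transpose_mul transpose_transpose transpose_diag_matrix matrix_mul_assoc)
  then have S: "transpose Q ** K = U ** (diag_matrix g ** transpose U)"
    by (simp add: UU matrix_mul_assoc g_def diag_matrix_mult[symmetric])
  have tr: "trace (transpose Q ** K) = (\<Sum>i\<in>UNIV. e $ i * d $ i)"
    unfolding S by (subst trace_mul_sym)
      (simp add: matrix_mul_assoc[symmetric] UU trace_diag_matrix g_def)
  define z where "z = transpose U *v x"
  have "diag_matrix g *v z = transpose U *v ((transpose Q ** K) *v x)"
    unfolding S z_def matrix_vector_mul_assoc by (simp add: matrix_mul_assoc UU)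
  also have "\<dots> = trace (transpose Q ** K) *\<^sub>R z"
    unfolding x z_def by (simp only: matrix_vector_mult_scaleR)
  finally have "(diag_matrix g *v z) $ i = (trace (transpose Q ** K) *\<^sub>R z) $ i" for i
    by simp
  then have "z = 0"
    by (intro trace_diag_eigenvector_zero[OF d distinct e]) (simp_all add: tr g_def)
  then have "U *v z = 0" by simp
  then show "x = 0"
    unfolding z_def matrix_vector_mul_assoc UU by simp
qed

theorem lemma4p1:
  fixes E \<Sigma>\<^sub>E :: "real^'n::{finite,linorder}^3"
    and U\<^sub>E :: "real^3^3"
    and V\<^sub>E W W\<^sub>0 :: "real^'n::{finite,linorder}^'n::{finite,linorder}"
    and \<sigma> d :: "real^3"
    and K :: "real^3^3"
  assumes "rank E = 3"
    and "E = U\<^sub>E ** \<Sigma>\<^sub>E ** transpose V\<^sub>E"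
    and "orthogonal_matrix U\<^sub>E"
    and "orthogonal_matrix V\<^sub>E"
    and "\<Sigma>\<^sub>E \<in> Diag_plus"
    and "\<forall>i j. index_pos i = index_pos j \<longrightarrow> \<Sigma>\<^sub>E $ i $ j = \<sigma> $ i"
    and "positive_definite W"
    and "W = V\<^sub>E ** W\<^sub>0 ** transpose V\<^sub>E"
    and "W\<^sub>0 \<in> Diag_plus"
    and "\<forall>i. 0 < d $ i"
    and "\<forall>(i::3) (j::'n). index_pos i = index_pos j \<longrightarrow> W\<^sub>0 $ j $ j = d $ i / (\<sigma> $ i)\<^sup>2"
    and "K = E ** W ** transpose E"
  shows "positive_definite K
    \<and> eigendecomposition K U\<^sub>E d
    \<and> ((\<forall>i j. i \<noteq> j \<longrightarrow> d $ i \<noteq> d $ j) \<longrightarrow>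
        morse_function_on TYPE(real^3) SO3 (\<lambda>Q. trace_inner (mat 1 - Q) K)
        \<and> (let a = (\<lambda>i. column i (mat 1 :: real^3^3));
               Q' = (\<lambda>i. 2 *\<^sub>R (U\<^sub>E ** ((columnvector (a i) :: real^1^3) ** transpose (columnvector (a i)))
                              ** transpose U\<^sub>E) - mat 1)
           in {Q. critical_point TYPE(real^3) SO3 (\<lambda>Q. trace_inner (mat 1 - Q) K) Q}
                = insert (mat 1) (range Q')))"
proof -
  note U = assms(3) and d = assms(10)[rule_format]
  \<comment> \<open>The factors \<open>V\<^sub>E\<close> of \<open>E\<close> and of \<open>W\<close>
    cancel.\<close>
  have "K = U\<^sub>E ** (\<Sigma>\<^sub>E ** W\<^sub>0 ** transpose \<Sigma>\<^sub>E) ** transpose U\<^sub>E"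
    unfolding assms(12,8,2)
    by (simp add: matrix_transpose_mul matrix_mul_assoc[symmetric] orthogonal_matrix_cancel[OF assms(4)])
  \<comment> \<open>Rank 3 forces at least three columns, so every row of
    \<open>\<Sigma>\<^sub>E\<close> has a diagonal entry.\<close>
  moreover have "CARD(3) \<le> CARD('n)"
    using rank_bound[of E] assms(1) by simp
  then have "\<Sigma>\<^sub>E ** W\<^sub>0 ** transpose \<Sigma>\<^sub>E = diag_matrix d"
    using assms by (intro Diag_plus_conj[of _ _ \<sigma>]) auto
  ultimately have K: "K = U\<^sub>E ** diag_matrix d ** transpose U\<^sub>E"
    by simp
  have UU: "U\<^sub>E ** transpose U\<^sub>E = mat 1"
    using U by (simp add: orthogonal_matrix_def)
  show ?thesis
  proof (intro conjI impI)
    show "positive_definite K" "eigendecomposition K U\<^sub>E d"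
      unfolding K using U d by (auto intro: positive_definite_diag_conj eigendecomposition_diag_conj)
    assume "\<forall>i j. i \<noteq> j \<longrightarrow> d $ i \<noteq> d $ j"
    then have distinct: "\<And>i j. i \<noteq> j \<Longrightarrow> d $ i \<noteq> d $ j"
      by blast
    show "morse_function_on TYPE(real^3) SO3 (\<lambda>Q. trace_inner (mat 1 - Q) K)"
      by (rule morse_function_cost) (rule rotation_symmetric_trace_eigenvector[OF U d distinct K])
    have "critical_point TYPE(real^3) SO3 (\<lambda>Q. trace_inner (mat 1 - Q) K) Q \<longleftrightarrow>
        (\<exists>e. (\<forall>i. (e $ i)\<^sup>2 = 1) \<and> prod (($) e) UNIV = 1 \<and>
          Q = U\<^sub>E ** diag_matrix e ** transpose U\<^sub>E)" for Q
      by (rule trans[OF critical_point_SO3_iff rotation_symmetric_conj_iff[OF U d distinct K]])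
    then have "{Q. critical_point TYPE(real^3) SO3 (\<lambda>Q. trace_inner (mat 1 - Q) K) Q} =
        (\<lambda>e. U\<^sub>E ** diag_matrix e ** transpose U\<^sub>E) ` {e. (\<forall>i. (e $ i)\<^sup>2 = 1) \<and> prod (($) e) UNIV = 1}"
      by auto
    \<comment> \<open>The all-ones sign vector gives the identity, and the other three give the
      half-turns.\<close>
    also have "\<dots> = insert (mat 1)
        (range (\<lambda>i. U\<^sub>E ** diag_matrix (\<chi> j. if j = i then 1 else - 1) ** transpose U\<^sub>E))"
      unfolding sign_vectors_3 by (simp add: image_image diag_matrix_1 UU)
    finally show "let a = (\<lambda>i. column i (mat 1 :: real^3^3));
               Q' = (\<lambda>i. 2 *\<^sub>R (U\<^sub>E ** ((columnvector (a i) :: real^1^3) ** transpose (columnvector (a i)))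
                              ** transpose U\<^sub>E) - mat 1)
           in {Q. critical_point TYPE(real^3) SO3 (\<lambda>Q. trace_inner (mat 1 - Q) K) Q}
                = insert (mat 1) (range Q')"
      unfolding Let_def half_turn_diag[OF U] .
  qed
qed

end
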